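(* There exists a polynomial-time algorithm which, given input $(A,b)$, where $A=(a_{11},\ldots,a_{1n})\in\mathbb{Z}^{1\times n}_{>0}$, $n\ge 2$, satisfies (i) $\gcd(a_{11},\ldots,a_{1n})=1$, (ii) $\{\boldsymbol{x}\in\mathbb{R}^n_{\ge 0}: A\boldsymbol{x}=0\}=\{\boldsymbol{0}\}$, and $b\in\mathbb{Z}$ satisfies $b>G(A)$, computes a nonnegative integer solution $\boldsymbol{x}\in\mathbb{Z}^n_{\ge 0}$ to the equation $A\boldsymbol{x}=b$.
   Context: The dimension $n$ is part of the input (not fixed). Polynomial time means polynomial in the binary encoding size of the input $(A,b)$. Set $f_1=a_{11}$ and $f_i=\gcd(a_{11},\ldots,a_{1i})$ for $i\in\{2,\ldots,n\}$. Then $$G(A):=a_{12}\frac{f_1}{f_2}+a_{13}\frac{f_2}{f_3}+\cdots+a_{1n}\frac{f_{n-1}}{f_n}-\sum_{i=1}^n a_{1i}.$$ *)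

theory Defs
  imports
    "HOL-Library.Log_Nat"
    "HOL-Computational_Algebra.Polynomial"
    "Jordan_Normal_Form.Matrix"
begin

text \<open>
  Algorithms are programs of the random access machine of Aho, Hopcroft and Ullman
  (The Design and Analysis of Computer Algorithms, Sections 1.2 and 1.3) under the
  logarithmic cost criterion: every instruction is charged the number of bits of all integers
  and addresses it touches. Running times in this model and on multitape Turing machines are
  polynomially related. Register 0 is the accumulator. A computation has a result only if it
  reaches HALT; a jump outside the program, an access to a negative address, a division by
  zero and reading beyond the end of the input leave the machine stuck without a result.
\<close>

datatype addr = Dir nat | Ind nat

datatype operand = Lit int | At addr

datatype instr =
    LOAD operand | STORE addr
  | ADD operand | SUB operand | MULT operand | DIV operand
  | READ addr | WRITE operand
  | JUMP nat | JGTZ nat | JZERO nat | HALT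

type_synonym program = "instr list"

text \<open>Program counter, registers, unread part of the input tape, output written so far.\<close>
type_synonym config = "nat \<times> (nat \<Rightarrow> int) \<times> int list \<times> int list"

text \<open>The number of binary digits of \<open>\<bar>k\<bar>\<close>, where 0 has one digit.\<close>
definition len :: "int \<Rightarrow> nat" where
  "len k = (if k = 0 then 1 else floorlog 2 (nat \<bar>k\<bar>))"

fun addr_loc :: "(nat \<Rightarrow> int) \<Rightarrow> addr \<Rightarrow> nat option" where
  "addr_loc m (Dir i) = Some i"
| "addr_loc m (Ind i) = (if m i \<ge> 0 then Some (nat (m i)) else None)"

fun addr_cost :: "(nat \<Rightarrow> int) \<Rightarrow> addr \<Rightarrow> nat" where
  "addr_cost m (Dir i) = len (int i)"
| "addr_cost m (Ind i) = len (int i) + len (m i)"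

fun operand_val :: "(nat \<Rightarrow> int) \<Rightarrow> operand \<Rightarrow> int option" where
  "operand_val m (Lit k) = Some k"
| "operand_val m (At a) = map_option m (addr_loc m a)"

fun operand_cost :: "(nat \<Rightarrow> int) \<Rightarrow> operand \<Rightarrow> nat" where
  "operand_cost m (Lit k) = len k"
| "operand_cost m (At a) =
     addr_cost m a + (case addr_loc m a of None \<Rightarrow> 0 | Some j \<Rightarrow> len (m j))"

definition arith ::
  "(int \<Rightarrow> int \<Rightarrow> int) \<Rightarrow> operand \<Rightarrow> config \<Rightarrow> (nat \<times> config) option" where
  "arith f a = (\<lambda>(pc, m, inp, out).
     map_option (\<lambda>v. (len (m 0) + operand_cost m a, (pc + 1, m(0 := f (m 0) v), inp, out)))
       (operand_val m a))"

text \<open>The cost of an instruction together with the successor configuration.\<close>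
fun exec :: "instr \<Rightarrow> config \<Rightarrow> (nat \<times> config) option" where
  "exec (LOAD a) (pc, m, inp, out) =
     map_option (\<lambda>v. (operand_cost m a, (pc + 1, m(0 := v), inp, out))) (operand_val m a)"
| "exec (STORE a) (pc, m, inp, out) =
     map_option (\<lambda>j. (len (m 0) + addr_cost m a, (pc + 1, m(j := m 0), inp, out)))
       (addr_loc m a)"
| "exec (ADD a) c = arith (+) a c"
| "exec (SUB a) c = arith (-) a c"
| "exec (MULT a) c = arith (*) a c"
| "exec (DIV a) (pc, m, inp, out) =
     (if operand_val m a = Some 0 then None else arith (div) a (pc, m, inp, out))"
| "exec (READ a) (pc, m, inp, out) =
     (case inp of
        [] \<Rightarrow> None
      | k # inp' \<Rightarrow>
          map_option (\<lambda>j. (len k + addr_cost m a, (pc + 1, m(j := k), inp', out)))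
            (addr_loc m a))"
| "exec (WRITE a) (pc, m, inp, out) =
     map_option (\<lambda>v. (operand_cost m a, (pc + 1, m, inp, out @ [v]))) (operand_val m a)"
| "exec (JUMP l) (pc, m, inp, out) = Some (1, (l, m, inp, out))"
| "exec (JGTZ l) (pc, m, inp, out) =
     Some (len (m 0), (if m 0 > 0 then l else pc + 1, m, inp, out))"
| "exec (JZERO l) (pc, m, inp, out) =
     Some (len (m 0), (if m 0 = 0 then l else pc + 1, m, inp, out))"
| "exec HALT c = None"

inductive halts_from :: "program \<Rightarrow> config \<Rightarrow> int list \<Rightarrow> nat \<Rightarrow> bool" for P where
  halt: "pc < length P \<Longrightarrow> P ! pc = HALT \<Longrightarrow> halts_from P (pc, m, inp, out) out 1"
| step: "fst c < length P \<Longrightarrow> exec (P ! fst c) c = Some (k, c') \<Longrightarrow>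
         halts_from P c' out t \<Longrightarrow> halts_from P c out (k + t)"

definition computes_in_time :: "program \<Rightarrow> int list \<Rightarrow> int list \<Rightarrow> nat \<Rightarrow> bool" where
  "computes_in_time P inp out t \<longleftrightarrow> halts_from P (0, (\<lambda>_. 0), inp, []) out t"

lemma halts_from_deterministic:
  assumes "halts_from P c out t" "halts_from P c out' t'"
  shows "out' = out \<and> t' = t"
  using assms
proof (induction arbitrary: out' t' rule: halts_from.induct)
  case (halt pc m inp out)
  have "fst (pc, m, inp, out) = pc" by simp
  with halt.hyps have stop: "exec (P ! fst (pc, m, inp, out)) (pc, m, inp, out) = None"
    by simp
  from halt.prems show ?case
  proof cases
    case halt
    then show ?thesis by simp
  next
    case step
    with stop show ?thesis by simp
  qed
next
  case (step c k c' out t)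
  from step.prems show ?case
  proof cases
    case halt
    with step.hyps(2) show ?thesis by simp
  next
    case (step k2 c2 t2)
    with \<open>exec (P ! fst c) c = Some (k, c')\<close> have "k2 = k" "c2 = c'" by simp_all
    with step(4) have "halts_from P c' out' t2" by simp
    from local.step.IH[OF this] show ?thesis using step(1) \<open>k2 = k\<close> by simp
  qed
qed

text \<open>
  Matrix and vector indices start at 0. The dimension is part of the input: it precedes the
  entries of the row and the right-hand side on the input tape.
\<close>
definition encode_instance :: "int mat \<Rightarrow> int \<Rightarrow> int list" where
  "encode_instance A b = int (dim_col A) # list_of_vec (row A 0) @ [b]"

definition encoding_size :: "int list \<Rightarrow> nat" where
  "encoding_size xs = (\<Sum>k\<leftarrow>xs. len k)"

definition f_gcd :: "int mat \<Rightarrow> nat \<Rightarrow> int" where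
  "f_gcd A i = (if i = 0 then A $$ (0, 0) else (GCD j\<in>{..i}. A $$ (0, j)))"

text \<open>The divisions are exact, since each \<open>f_gcd A i\<close> divides its predecessor.\<close>
definition G :: "int mat \<Rightarrow> int" where
  "G A = (\<Sum>i\<in>{1..<dim_col A}. A $$ (0, i) * (f_gcd A (i - 1) div f_gcd A i))
       - (\<Sum>i\<in>{..<dim_col A}. A $$ (0, i))"

end

theory Submission
  imports Defs
begin

text \<open>
  The program first computes the gcds \<open>f\<^sub>i\<close> by the extended Euclidean algorithm, which also yields
  \<open>v\<^sub>i\<close> with \<open>v\<^sub>i a\<^sub>1\<^sub>i \<equiv> f\<^sub>i\<close> modulo \<open>f\<^sub>i\<^sub>-\<^sub>1\<close>. Going back from \<open>i = n\<close> to \<open>2\<close>, it takes for \<open>x\<^sub>i\<close> the unique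
  number in \<open>{0, \<dots>, f\<^sub>i\<^sub>-\<^sub>1 / f\<^sub>i - 1}\<close> that makes the remaining right-hand side divisible by \<open>f\<^sub>i\<^sub>-\<^sub>1\<close>.
  Since \<open>b > G(A)\<close>, what remains at the end is a multiple of \<open>a\<^sub>1\<^sub>1\<close> greater than \<open>-a\<^sub>1\<^sub>1\<close>, hence
  nonnegative. The factors in the Euclidean algorithm are reduced modulo \<open>f\<^sub>i\<^sub>-\<^sub>1\<close>, so that all
  numbers stay as short as the input.
\<close>

section \<open>Bit lengths\<close>

lemma len_ge_1: "1 \<le> len k"
  by (auto simp: len_def floorlog_def)

lemma len_le_iff: "0 < u \<Longrightarrow> len k \<le> u \<longleftrightarrow> \<bar>k\<bar> < 2 ^ u"
proof -
  assume u: "0 < u"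
  have "nat \<bar>k\<bar> < 2 ^ u \<longleftrightarrow> \<bar>k\<bar> < 2 ^ u"
    by (simp add: nat_less_iff)
  then show ?thesis using u
    by (auto simp: len_def floorlog_le_iff)
qed

lemma len_bound: "\<bar>k\<bar> < 2 ^ len k"
  using len_le_iff[of "len k" k] len_ge_1[of k] by simp

lemma len_mono: "\<bar>x\<bar> \<le> \<bar>y\<bar> \<Longrightarrow> len x \<le> len y"
  using len_le_iff[of "len y" x] len_bound[of y] len_ge_1[of y] by simp

text \<open>The sum bound is cruder than the maximum plus one, but has the same form as for
  products, so all arithmetic instructions can be treated alike. It rests on
  \<open>s + t \<le> s * t\<close> for \<open>s, t \<ge> 2\<close>.\<close>

lemma len_add: "len (x + y) \<le> len x + len y"
proof -
  have "2 ^ len x + (2::int) ^ len y \<le> 2 ^ len x * 2 ^ len y"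
  proof -
    have "(2::int) \<le> 2 ^ len x" "(2::int) \<le> 2 ^ len y"
      using power_increasing[OF len_ge_1, of "2::int"] by auto
    then have "0 \<le> (2 ^ len x - 2) * ((2::int) ^ len y - 1) + (2 ^ len y - 2)" by auto
    then show ?thesis by (simp add: algebra_simps)
  qed
  then have "\<bar>x + y\<bar> < 2 ^ (len x + len y)"
    using len_bound[of x] len_bound[of y] by (simp add: power_add)
  then show ?thesis using len_ge_1[of x] by (simp add: len_le_iff)
qed

lemma len_diff: "len (x - y) \<le> len x + len y"
  using len_add[of x "- y"] by (simp add: len_def split: if_splits)

lemma len_mult: "len (x * y) \<le> len x + len y"
proof -
  have "\<bar>x * y\<bar> < 2 ^ (len x + len y)"
    using mult_strict_mono'[OF len_bound len_bound, of x y] by (simp add: power_add abs_mult)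
  then show ?thesis using len_ge_1[of x] by (simp add: len_le_iff)
qed

lemma len_div: "len (x div y) \<le> len x"
proof (rule len_mono)
  have "\<bar>x div y\<bar> \<le> \<bar>x\<bar>" if "0 < y" for x y :: int
  proof (cases "0 \<le> x")
    case True
    then show ?thesis using that zdiv_mono2[of x 1 y] by (simp add: pos_imp_zdiv_nonneg_iff)
  next
    case False
    then have "x div 1 \<le> x div y" using that by (intro zdiv_mono2_neg) auto
    moreover have "x div y < 0" using False that by (simp add: neg_imp_zdiv_neg_iff pos_imp_zdiv_neg_iff)
    ultimately show ?thesis by simp
  qed
  \<comment> \<open>Negating both arguments reduces a negative divisor to a positive one; division
    by 0 gives 0.\<close>
  from this[of y x] this[of "- y" "- x"] show "\<bar>x div y\<bar> \<le> \<bar>x\<bar>"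
    by (cases y "0::int" rule: linorder_cases) auto
qed

section \<open>Cost of machine runs\<close>

text \<open>The static part of an instruction's cost: the digits of the constants in its text,
  bounded once and for all for a fixed program.\<close>

primrec addr_len :: "addr \<Rightarrow> nat" where
  "addr_len (Dir i) = len (int i)"
| "addr_len (Ind i) = len (int i)"

primrec operand_len :: "operand \<Rightarrow> nat" where
  "operand_len (Lit k) = len k"
| "operand_len (At a) = addr_len a"

primrec instr_len :: "instr \<Rightarrow> nat" where
  "instr_len (LOAD a) = operand_len a"
| "instr_len (STORE a) = addr_len a"
| "instr_len (ADD a) = operand_len a"
| "instr_len (SUB a) = operand_len a"
| "instr_len (MULT a) = operand_len a"
| "instr_len (DIV a) = operand_len a"
| "instr_len (READ a) = addr_len a"
| "instr_len (WRITE a) = operand_len a"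
| "instr_len (JUMP l) = 1"
| "instr_len (JGTZ l) = 1"
| "instr_len (JZERO l) = 1"
| "instr_len HALT = 1"

text \<open>The unread input is included because READ moves it into memory; the output is never read
  back.\<close>

definition bounded :: "nat \<Rightarrow> (nat \<Rightarrow> int) \<Rightarrow> int list \<Rightarrow> bool" where
  "bounded u m inp \<longleftrightarrow> (\<forall>i. len (m i) \<le> u) \<and> (\<forall>k\<in>set inp. len k \<le> u)"

lemma bounded_pos: "bounded u m inp \<Longrightarrow> 1 \<le> u"
  using len_ge_1 order_trans unfolding bounded_def by blast

lemma bounded_mono: "bounded u m inp \<Longrightarrow> u \<le> v \<Longrightarrow> bounded v m inp"
  unfolding bounded_def using order_trans by blast

lemma bounded_upd: "bounded u m inp \<Longrightarrow> len v \<le> u \<Longrightarrow> bounded u (m(i := v)) inp"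
  unfolding bounded_def by simp

lemma addr_cost_le:
  assumes "bounded u m inp" "addr_len a \<le> u"
  shows "addr_cost m a \<le> 2 * u"
proof (cases a)
  case (Ind i)
  moreover have "len (m i) \<le> u" using assms(1) by (simp add: bounded_def)
  ultimately show ?thesis using assms(2) by simp
qed (use assms(2) in simp)

lemma operand_cost_le:
  assumes "bounded u m inp" "operand_len a \<le> u"
  shows "operand_cost m a \<le> 3 * u"
proof (cases a)
  case (At l)
  have "len (m j) \<le> u" for j using assms(1) by (simp add: bounded_def)
  then have "(case addr_loc m l of None \<Rightarrow> 0 | Some j \<Rightarrow> len (m j)) \<le> u"
    by (simp split: option.split)
  moreover have "addr_cost m l \<le> 2 * u" using assms At by (intro addr_cost_le) auto
  ultimately show ?thesis using At by simp
qed (use assms(2) in simp)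

lemma operand_val_len:
  "bounded u m inp \<Longrightarrow> operand_len a \<le> u \<Longrightarrow> operand_val m a = Some v \<Longrightarrow> len v \<le> u"
  by (cases a) (auto simp: bounded_def)

lemma exec_arith_bounds:
  assumes "arith f a (pc, m, inp, out) = Some (k, (pc', m', inp', out'))"
    and "\<And>x y. len (f x y) \<le> len x + len y"
    and "bounded u m inp" and "operand_len a \<le> u"
  shows "k \<le> 4 * u \<and> bounded (2 * u) m' inp'"
proof -
  obtain v where v: "operand_val m a = Some v" and k: "k = len (m 0) + operand_cost m a"
    and m': "m' = m(0 := f (m 0) v)" "inp' = inp"
    using assms(1) by (auto simp: arith_def)
  have "len (m 0) \<le> u" using assms(3) by (simp add: bounded_def)
  moreover have "len (f (m 0) v) \<le> 2 * u"
    using assms(2)[of "m 0" v] operand_val_len[OF assms(3,4) v] \<open>len (m 0) \<le> u\<close> by simp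
  ultimately show ?thesis using operand_cost_le[OF assms(3,4)] k m'
      bounded_upd[OF bounded_mono[OF assms(3)]] by simp
qed

text \<open>The most expensive case touches four numbers: the accumulator, an address in the text,
  the address stored there, and the operand. Only arithmetic lengthens numbers, at most to the sum
  of two lengths.\<close>

lemma exec_bounds:
  assumes "exec ins (pc, m, inp, out) = Some (k, (pc', m', inp', out'))"
    and b: "bounded u m inp" and l: "instr_len ins \<le> u"
  shows "k \<le> 4 * u \<and> bounded (2 * u) m' inp'"
proof -
  have m0: "len (m i) \<le> u" for i using b by (simp add: bounded_def)
  have b2: "bounded (2 * u) m inp" using bounded_mono[OF b] by simp
  have u: "1 \<le> u" using bounded_pos[OF b] .
  note ar = exec_arith_bounds[OF _ _ b]
  show ?thesis
  proof (cases ins)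
    case (LOAD a)
    then show ?thesis using assms(1) l operand_cost_le[OF b, of a] operand_val_len[OF b, of a]
        bounded_upd[OF b2] by fastforce
  next
    case (STORE a)
    then show ?thesis using assms(1) l addr_cost_le[OF b, of a] m0[of 0] bounded_upd[OF b2]
      by fastforce
  next
    case (ADD a)
    then show ?thesis using assms(1) l ar[OF _ len_add] by simp
  next
    case (SUB a)
    then show ?thesis using assms(1) l ar[OF _ len_diff] by simp
  next
    case (MULT a)
    then show ?thesis using assms(1) l ar[OF _ len_mult] by simp
  next
    case (DIV a)
    have "len (x div y) \<le> len x + len y" for x y using len_div[of x y] by simp
    with DIV show ?thesis using assms(1) l ar by (auto split: if_splits)
  next
    case (READ a)
    then obtain x where x: "inp = x # inp'" using assms(1) by (auto split: list.splits)
    then have "len x \<le> u" "bounded (2 * u) m inp'" using b b2 by (auto simp: bounded_def)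
    then show ?thesis using assms(1) READ x l addr_cost_le[OF b, of a] bounded_upd[of "2*u" m inp']
      by fastforce
  next
    case (WRITE a)
    then show ?thesis using assms(1) l operand_cost_le[OF b, of a] b2 by auto
  next
    case (JUMP x)
    then show ?thesis using assms(1) b2 u by auto
  next
    case (JGTZ x)
    then show ?thesis using assms(1) b2 m0[of 0] by auto
  next
    case (JZERO x)
    then show ?thesis using assms(1) b2 m0[of 0] by auto
  next
    case HALT
    then show ?thesis using assms(1) by simp
  qed
qed

text \<open>A cost-free functional execution, so that simplification can run a fixed block
  symbolically.\<close>

primrec nsteps :: "program \<Rightarrow> nat \<Rightarrow> config \<Rightarrow> config option" where
  "nsteps P 0 c = Some c"
| "nsteps P (Suc k) c =
     (if fst c < length P then Option.bind (map_option snd (exec (P ! fst c) c)) (nsteps P k)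
      else None)"

lemma nsteps_numeral:
  "nsteps P (numeral k) c =
     (if fst c < length P
      then Option.bind (map_option snd (exec (P ! fst c) c)) (nsteps P (pred_numeral k))
      else None)"
  by (simp add: numeral_eq_Suc)

text \<open>Formulated backwards: every halting run from \<open>c'\<close> extends to one from
  \<open>c\<close> with the same output, so that pieces of a run compose at once.\<close>

definition reaches :: "program \<Rightarrow> config \<Rightarrow> nat \<Rightarrow> config \<Rightarrow> bool" where
  "reaches P c T c' \<longleftrightarrow>
     (\<exists>t\<le>T. \<forall>out t'. halts_from P c' out t' \<longrightarrow> halts_from P c out (t + t'))"

lemma reaches_trans:
  assumes "reaches P c T c'" "reaches P c' T' c''"
  shows "reaches P c (T + T') c''"
proof -
  obtain t t' where "t \<le> T" "t' \<le> T'"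
    and "\<And>out s. halts_from P c' out s \<Longrightarrow> halts_from P c out (t + s)"
    and "\<And>out s. halts_from P c'' out s \<Longrightarrow> halts_from P c' out (t' + s)"
    using assms unfolding reaches_def by metis
  then show ?thesis unfolding reaches_def
    by (intro exI[of _ "t + t'"]) (auto simp: add.assoc)
qed

lemma reaches_mono: "reaches P c T c' \<Longrightarrow> T \<le> T' \<Longrightarrow> reaches P c T' c'"
  unfolding reaches_def using order_trans by blast

text \<open>A single instruction at most doubles the length of the longest integer in the memory, so
  that a block of constant length has linear cost whatever it computes.\<close>
lemma reaches_nsteps:
  assumes "nsteps P k (pc, m, inp, out) = Some c'"
    and "bounded u m inp" and "\<forall>ins\<in>set P. instr_len ins \<le> u"
  shows "reaches P (pc, m, inp, out) (4 ^ Suc k * u) c'"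
  using assms
proof (induction k arbitrary: pc m inp out u)
  case 0
  then show ?case by (auto simp: reaches_def)
next
  case (Suc k)
  from Suc.prems(1) obtain t pc1 m1 inp1 out1 where pc: "pc < length P"
    and e: "exec (P ! pc) (pc, m, inp, out) = Some (t, (pc1, m1, inp1, out1))"
    and n: "nsteps P k (pc1, m1, inp1, out1) = Some c'"
    by (auto simp: bind_eq_Some_conv split: if_splits)
  have "instr_len (P ! pc) \<le> u" using pc Suc.prems(3) by simp
  from exec_bounds[OF e Suc.prems(2) this] have t: "t \<le> 4 * u" and b: "bounded (2 * u) m1 inp1"
    by auto
  \<comment> \<open>The memory bound has doubled, so the induction hypothesis is used at
    \<open>2 * u\<close>; base 4 leaves room for this and for the present instruction.\<close>
  have "reaches P (pc1, m1, inp1, out1) (4 ^ Suc k * (2 * u)) c'"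
    using Suc.IH[OF n b] Suc.prems(3) by fastforce
  moreover have "reaches P (pc, m, inp, out) (4 * u) (pc1, m1, inp1, out1)"
    unfolding reaches_def using t halts_from.step[of "(pc, m, inp, out)"] pc e by auto
  ultimately have "reaches P (pc, m, inp, out) (4 * u + 4 ^ Suc k * (2 * u)) c'"
    using reaches_trans by blast
  moreover have "4 * u + 4 ^ Suc k * (2 * u) \<le> 4 ^ Suc (Suc k) * u"
  proof -
    have "(1::nat) \<le> 4 ^ k" by simp
    then have "4 * u * 1 \<le> 4 * u * 4 ^ k" by (intro mult_left_mono) auto
    then show ?thesis by simp
  qed
  ultimately show ?case by (rule reaches_mono)
qed

section \<open>The program\<close>

abbreviation reg :: "nat \<Rightarrow> operand" where
  "reg i \<equiv> At (Dir i)"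

text \<open>Registers: 2 counts the remaining entries, 3 is a pointer into the table at addresses from
  12 on, 4 is \<open>f\<^sub>i\<close>, 5 is the current entry and later the quotient of the remaining right-hand side
  by \<open>f\<^sub>i\<close>, 6 and 7 are the remainders of the Euclidean algorithm, and 8 and 9 the factors of the
  current entry in them modulo \<open>f\<^sub>i\<close>. The table has three cells per entry.
  The copies into otherwise dead registers at the end of a block keep the memory small.\<close>
definition prog :: program where
  "prog = [
     READ (Dir 2), READ (Dir 4), LOAD (Lit 12), STORE (Dir 3),
     \<comment> \<open>4: forward pass\<close>
     LOAD (reg 2), SUB (Lit 1), STORE (Dir 2), JZERO 68,
     READ (Dir 5), LOAD (reg 4), STORE (Dir 6), LOAD (reg 5), STORE (Dir 7),
     LOAD (Lit 0), STORE (Dir 8), LOAD (Lit 1), STORE (Dir 9),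
     \<comment> \<open>17: Euclidean algorithm\<close>
     LOAD (reg 7), JZERO 48,
     LOAD (reg 6), DIV (reg 7), STORE (Dir 10), MULT (reg 9), STORE (Dir 11),
     LOAD (reg 8), SUB (reg 11), STORE (Dir 11), DIV (reg 4), MULT (reg 4), STORE (Dir 8),
     LOAD (reg 11), SUB (reg 8), STORE (Dir 11), LOAD (reg 9), STORE (Dir 8),
     LOAD (reg 11), STORE (Dir 9),
     LOAD (reg 10), MULT (reg 7), STORE (Dir 10), LOAD (reg 6), SUB (reg 10), STORE (Dir 10),
     LOAD (reg 7), STORE (Dir 6), LOAD (reg 10), STORE (Dir 7), JUMP 17,
     \<comment> \<open>48: append to the table\<close>
     LOAD (reg 8), STORE (Ind 3), LOAD (reg 3), ADD (Lit 1), STORE (Dir 3),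
     LOAD (reg 4), DIV (reg 6), STORE (Ind 3), LOAD (reg 3), ADD (Lit 1), STORE (Dir 3),
     LOAD (reg 5), DIV (reg 6), STORE (Ind 3), LOAD (reg 3), ADD (Lit 1), STORE (Dir 3),
     LOAD (reg 6), STORE (Dir 4), JUMP 4,
     \<comment> \<open>68: backward pass\<close>
     READ (Dir 5),
     LOAD (reg 3), SUB (Lit 12), JZERO 107,
     LOAD (reg 3), SUB (Lit 1), STORE (Dir 3), LOAD (At (Ind 3)), STORE (Dir 6),
     LOAD (reg 3), SUB (Lit 1), STORE (Dir 3), LOAD (At (Ind 3)), STORE (Dir 7),
     LOAD (reg 3), SUB (Lit 1), STORE (Dir 3), LOAD (At (Ind 3)),
     MULT (reg 5), STORE (Dir 8), DIV (reg 7), MULT (reg 7), STORE (Dir 9),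
     LOAD (reg 8), SUB (reg 9), STORE (Ind 3), STORE (Dir 8), STORE (Dir 9),
     MULT (reg 6), STORE (Dir 10), LOAD (reg 5), SUB (reg 10), DIV (reg 7), STORE (Dir 5),
     STORE (Dir 10), LOAD (reg 2), ADD (Lit 1), STORE (Dir 2), JUMP 69,
     \<comment> \<open>107: output\<close>
     WRITE (reg 5),
     LOAD (reg 2), JZERO 117, SUB (Lit 1), STORE (Dir 2), WRITE (At (Ind 3)),
     LOAD (reg 3), ADD (Lit 3), STORE (Dir 3), JUMP 108,
     HALT]"

section \<open>Symbolic execution of the straight-line blocks\<close>

lemma length_prog: "length prog = 118"
  by (simp add: prog_def)

text \<open>All literals and addresses in the text are at most 12, which has four binary
  digits.\<close>

lemma prog_instr_len: "\<forall>ins\<in>set prog. instr_len ins \<le> 4"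
  by (simp add: prog_def len_le_iff)

text \<open>Unfolds \<open>prog\<close> only under an index, so that the program stays folded while
  the fetched instructions are evaluated.\<close>

lemmas prog_nth = arg_cong[OF prog_def, of "\<lambda>P. P ! i" for i]

lemma nat_int_add:
  "nat (int p + 1) = Suc p" "nat (int p + numeral k) = p + numeral k"
  "nat (1 + int p) = Suc p" "nat (numeral k + int p) = numeral k + p"
  by (simp_all add: nat_add_distrib)

lemmas prog_exec = nsteps_numeral length_prog prog_nth arith_def nat_int_add

lemma init_block:
  "nsteps prog 4 (0, m, n # x # inp, out) =
     Some (4, m(2 := n, 4 := x, 0 := 12, 3 := 12), inp, out)"
  by (simp add: prog_exec)

lemma forward_exit_block:
  "m 2 = 1 \<Longrightarrow> nsteps prog 4 (4, m, inp, out) = Some (68, m(0 := 0, 2 := 0), inp, out)"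
  by (simp add: prog_exec)

lemma forward_block:
  "m 2 \<noteq> 1 \<Longrightarrow> nsteps prog 13 (4, m, x # inp, out) =
     Some (17, m(2 := m 2 - 1, 5 := x, 6 := m 4, 7 := x, 8 := 0, 0 := 1, 9 := 1), inp, out)"
  by (simp add: prog_exec)

lemma euclid_exit_block:
  "m 7 = 0 \<Longrightarrow> nsteps prog 2 (17, m, inp, out) = Some (48, m(0 := 0), inp, out)"
  by (simp add: prog_exec)

text \<open>Both remainders arise as \<open>z - z div y * y\<close>, the machine having no modulo
  instruction.\<close>

lemma euclid_block:
  assumes "m 7 \<noteq> 0" "m 4 \<noteq> 0"
  defines "r \<equiv> m 6 mod m 7" and "s \<equiv> (m 8 - m 6 div m 7 * m 9) mod m 4"
  shows "nsteps prog 31 (17, m, inp, out) =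
     Some (17, m(0 := r, 6 := m 7, 7 := r, 8 := m 9, 9 := s, 10 := r, 11 := s), inp, out)"
  using assms by (simp add: prog_exec minus_div_mult_eq_mod) (rule ext, simp)

text \<open>\<open>12 \<le> p\<close> keeps the indirect stores off the working registers.\<close>

lemma append_block:
  assumes "m 3 = int p" "12 \<le> p" "m 6 \<noteq> 0"
  shows "nsteps prog 20 (48, m, inp, out) =
     Some (4, m(p := m 8, p + 1 := m 4 div m 6, p + 2 := m 5 div m 6, 3 := int p + 3,
                0 := m 6, 4 := m 6), inp, out)"
  using assms by (simp add: prog_exec) (rule ext, simp)

lemma read_rhs_block:
  "nsteps prog (Suc 0) (68, m, b # inp, out) = Some (69, m(5 := b), inp, out)"
  by (simp add: prog_exec)

lemma backward_exit_block:
  "m 3 = 12 \<Longrightarrow> nsteps prog 3 (69, m, inp, out) = Some (107, m(0 := 0), inp, out)"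
  by (simp add: prog_exec)

text \<open>The new solution entry \<open>x\<close> overwrites the factor at \<open>p\<close>, so
  the table gradually turns into the solution; register 2 counts the entries for the output
  loop.\<close>

lemma backward_block:
  assumes "m 3 = int p + 3" "12 \<le> p" "m (p + 1) \<noteq> 0"
  defines "d \<equiv> m (p + 1)" and "e \<equiv> m (p + 2)"
  defines "x \<equiv> m p * m 5 mod d"
  defines "y \<equiv> (m 5 - x * e) div d"
  shows "nsteps prog 38 (69, m, inp, out) =
     Some (69, m(p := x, 3 := int p, 6 := e, 7 := d, 8 := x, 9 := x, 5 := y, 10 := y,
                 0 := m 2 + 1, 2 := m 2 + 1), inp, out)"
  using assms(1-3) unfolding y_def x_def e_def d_def
  by (simp add: prog_exec minus_div_mult_eq_mod) (rule ext, simp)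

lemma write_block:
  "nsteps prog (Suc 0) (107, m, inp, out) = Some (108, m, inp, out @ [m 5])"
  by (simp add: prog_exec)

lemma output_exit_block:
  "m 2 = 0 \<Longrightarrow> nsteps prog 2 (108, m, inp, out) = Some (117, m(0 := 0), inp, out)"
  by (simp add: prog_exec)

lemma output_block:
  assumes "m 3 = int p" "12 \<le> p" "m 2 \<noteq> 0"
  shows "nsteps prog 9 (108, m, inp, out) =
     Some (108, m(2 := m 2 - 1, 0 := int p + 3, 3 := int p + 3), inp, out @ [m p])"
  using assms by (simp add: prog_exec)

section \<open>Euclidean algorithm on the machine\<close>

text \<open>The longest block has 38 instructions, so the exponent 40 serves all blocks.\<close>

definition block_cost :: "nat \<Rightarrow> nat" where
  "block_cost u = 4 ^ 40 * u"

lemma reaches_block: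
  assumes "nsteps prog k (pc, m, inp, out) = Some c'" "k < 40" "bounded u m inp" "4 \<le> u"
  shows "reaches prog (pc, m, inp, out) (block_cost u) c'"
proof -
  have "\<forall>ins\<in>set prog. instr_len ins \<le> u"
    using prog_instr_len assms(4) order_trans by blast
  from reaches_nsteps[OF assms(1,3) this]
  have "reaches prog (pc, m, inp, out) (4 ^ Suc k * u) c'" .
  moreover have "(4::nat) ^ Suc k \<le> 4 ^ 40" using assms(2) by (intro power_increasing) auto
  then have "4 ^ Suc k * u \<le> block_cost u" unfolding block_cost_def by (rule mult_right_mono) simp
  ultimately show ?thesis by (rule reaches_mono)
qed

lemma len_le: "bounded u m inp \<Longrightarrow> len (m i) \<le> u"
  unfolding bounded_def by simp

text \<open>Each remainder is a combination of \<open>f\<close> and \<open>x\<close>. Only the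
  coefficient of \<open>x\<close> is tracked, modulo \<open>f\<close>, where the coefficient of
  \<open>f\<close> disappears.\<close>

definition euclid_inv :: "int \<Rightarrow> int \<Rightarrow> (nat \<Rightarrow> int) \<Rightarrow> bool" where
  "euclid_inv f x m \<longleftrightarrow>
     m 4 = f \<and> 0 < f \<and> 0 \<le> m 6 \<and> 0 \<le> m 7 \<and> gcd (m 6) (m 7) = gcd f x \<and>
     f dvd m 6 - m 8 * x \<and> f dvd m 7 - m 9 * x"

text \<open>The bound \<open>u\<close> is restored after the round, since the new values are
  remainders modulo \<open>m 7\<close> and modulo \<open>f\<close>. Hence the doubling per
  instruction does not compound over the loop.\<close>

lemma euclid_step:
  assumes inv: "euclid_inv f x m" and pos: "0 < m 7" and b: "bounded u m inp" and u: "4 \<le> u"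
  shows "\<exists>m'. reaches prog (17, m, inp, out) (block_cost u) (17, m', inp, out) \<and>
    bounded u m' inp \<and> euclid_inv f x m' \<and> m' 6 = m 7 \<and> m' 7 = m 6 mod m 7 \<and>
    (\<forall>j. j \<notin> {0, 6, 7, 8, 9, 10, 11} \<longrightarrow> m' j = m j)"
proof -
  define r s where "r = m 6 mod m 7" and "s = (m 8 - m 6 div m 7 * m 9) mod m 4"
  define m' where "m' = m(0 := r, 6 := m 7, 7 := r, 8 := m 9, 9 := s, 10 := r, 11 := s)"
  have f: "m 4 = f" "0 < f" using inv by (auto simp: euclid_inv_def)
  have "nsteps prog 31 (17, m, inp, out) = Some (17, m', inp, out)"
    unfolding m'_def r_def s_def using euclid_block[of m] pos f by simp
  then have reach: "reaches prog (17, m, inp, out) (block_cost u) (17, m', inp, out)"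
    by (rule reaches_block) (use b u in auto)
  have "len r \<le> len (m 7)" "len s \<le> len (m 4)"
    using pos f unfolding r_def s_def by (auto intro!: len_mono simp: less_imp_le)
  then have lens: "len r \<le> u" "len s \<le> u" using len_le[OF b] order_trans by blast+
  have "bounded u m' inp"
    unfolding m'_def by (intro bounded_upd b lens len_le[OF b])
  moreover have "euclid_inv f x m'"
  proof -
    have "f dvd m 6 - m 8 * x" "f dvd m 7 - m 9 * x" using inv by (auto simp: euclid_inv_def)
    moreover have "f dvd (m 8 - m 6 div m 7 * m 9) - s" unfolding s_def f(1) by (rule dvd_minus_mod)
    \<comment> \<open>The congruences of the two remainders are combined as in the division step;
      the last summand accounts for reducing the new coefficient to \<open>s\<close>.\<close>
    ultimately have "f dvd (m 6 - m 8 * x) - m 6 div m 7 * (m 7 - m 9 * x)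
        + ((m 8 - m 6 div m 7 * m 9) - s) * x"
      by (intro dvd_add[OF dvd_diff dvd_mult2] dvd_mult)
    also have "\<dots> = r - s * x"
      unfolding r_def by (simp add: algebra_simps flip: minus_div_mult_eq_mod)
    finally show ?thesis
      using inv pos unfolding euclid_inv_def m'_def by (simp add: r_def gcd.commute gcd_red_int[symmetric])
  qed
  ultimately show ?thesis using reach
    by (intro exI[of _ m']) (auto simp: m'_def r_def)
qed

text \<open>The slack factor \<open>Suc k\<close> makes this fit both the base case and an early
  exit in the loop induction.\<close>

lemma euclid_exit:
  assumes "euclid_inv f x m" "m 7 = 0" "bounded u m inp" "4 \<le> u"
  shows "\<exists>m'. reaches prog (17, m, inp, out) (Suc k * block_cost u) (48, m', inp, out) \<and>
    bounded u m' inp \<and> euclid_inv f x m' \<and> m' 7 = 0 \<and>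
    (\<forall>j. j \<notin> {0, 6, 7, 8, 9, 10, 11} \<longrightarrow> m' j = m j)"
proof -
  define m' where "m' = m(0 := 0)"
  have "reaches prog (17, m, inp, out) (block_cost u) (48, m', inp, out)"
    unfolding m'_def using euclid_exit_block[of m] assms by (intro reaches_block) auto
  then have "reaches prog (17, m, inp, out) (Suc k * block_cost u) (48, m', inp, out)"
    by (rule reaches_mono) simp
  moreover have "bounded u m' inp"
    unfolding m'_def using assms by (intro bounded_upd) (auto simp: len_def)
  moreover have "euclid_inv f x m'" "m' 7 = 0" using assms by (simp_all add: euclid_inv_def m'_def)
  ultimately show ?thesis by (intro exI[of _ m']) (auto simp: m'_def)
qed

text \<open>Each division at least halves the product of the two remainders.\<close>
lemma euclid_loop:
  assumes "euclid_inv f x m" "m 7 < m 6" "m 6 * m 7 < 2 ^ k" "bounded u m inp" "4 \<le> u"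
  shows "\<exists>m'. reaches prog (17, m, inp, out) (Suc k * block_cost u) (48, m', inp, out) \<and>
    bounded u m' inp \<and> euclid_inv f x m' \<and> m' 7 = 0 \<and>
    (\<forall>j. j \<notin> {0, 6, 7, 8, 9, 10, 11} \<longrightarrow> m' j = m j)"
  using assms
proof (induction k arbitrary: m)
  case 0
  have "\<not> 0 < m 7"
  proof
    assume "0 < m 7"
    then have "0 < m 6 * m 7" using 0(2) by (intro mult_pos_pos) auto
    then show False using 0(3) by simp
  qed
  then have "m 7 = 0" using 0 by (auto simp: euclid_inv_def)
  then show ?case using euclid_exit 0 by blast
next
  case (Suc k)
  show ?case
  proof (cases "m 7 = 0")
    case True
    then show ?thesis using euclid_exit Suc.prems by blast
  next
    case False
    then have pos: "0 < m 7" using Suc.prems(1) by (auto simp: euclid_inv_def)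
    obtain m1 where m1: "reaches prog (17, m, inp, out) (block_cost u) (17, m1, inp, out)"
      "bounded u m1 inp" "euclid_inv f x m1" "m1 6 = m 7" "m1 7 = m 6 mod m 7"
      "\<forall>j. j \<notin> {0, 6, 7, 8, 9, 10, 11} \<longrightarrow> m1 j = m j"
      using euclid_step[OF Suc.prems(1) pos Suc.prems(4,5)] by blast
    \<comment> \<open>As the quotient is at least 1, \<open>m 6\<close> is at least divisor plus
      remainder, hence at least twice the remainder.\<close>
    have "0 < m 6 div m 7"
      using pos Suc.prems(2) by (simp add: pos_imp_zdiv_pos_iff)
    then have "m 7 \<le> m 6 div m 7 * m 7"
      using pos mult_right_mono[of 1 "m 6 div m 7" "m 7"] by simp
    then have "2 * m1 7 \<le> m 6"
      using div_mult_mod_eq[of "m 6" "m 7"] pos_mod_bound[OF pos, of "m 6"] m1(5) by linarith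
    then have "m 7 * (2 * m1 7) \<le> m 7 * m 6" using pos by (intro mult_left_mono) auto
    then have "2 * (m1 6 * m1 7) < 2 * 2 ^ k"
      using Suc.prems(3) m1(4) by (simp add: mult.commute mult.left_commute)
    then have half: "m1 6 * m1 7 < 2 ^ k" by simp
    have lt: "m1 7 < m1 6" using pos m1 by simp
    obtain m' where m': "reaches prog (17, m1, inp, out) (Suc k * block_cost u) (48, m', inp, out)"
      "bounded u m' inp" "euclid_inv f x m'" "m' 7 = 0"
      "\<forall>j. j \<notin> {0, 6, 7, 8, 9, 10, 11} \<longrightarrow> m' j = m1 j"
      using Suc.IH[OF m1(3) lt half m1(2) Suc.prems(5)] by blast
    have "reaches prog (17, m, inp, out) (Suc (Suc k) * block_cost u) (48, m', inp, out)"
      using reaches_trans[OF m1(1) m'(1)] by simp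
    then show ?thesis using m' m1(6) by (intro exI[of _ m']) auto
  qed
qed

text \<open>A first round is split off to establish \<open>m 7 < m 6\<close>, since \<open>x\<close>
  may exceed \<open>f\<close>. Afterwards both remainders are below \<open>2 ^ u\<close>, so the
  halving argument starts from \<open>2 ^ (2 * u)\<close>.\<close>

lemma euclid_correct:
  assumes "euclid_inv f x m" "0 < m 7" "bounded u m inp" "4 \<le> u"
  shows "\<exists>m'. reaches prog (17, m, inp, out) ((2 * u + 2) * block_cost u) (48, m', inp, out) \<and>
    bounded u m' inp \<and> m' 6 = gcd f x \<and> f dvd gcd f x - m' 8 * x \<and>
    (\<forall>j. j \<notin> {0, 6, 7, 8, 9, 10, 11} \<longrightarrow> m' j = m j)"
proof -
  obtain m1 where m1: "reaches prog (17, m, inp, out) (block_cost u) (17, m1, inp, out)"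
    "bounded u m1 inp" "euclid_inv f x m1" "m1 6 = m 7" "m1 7 = m 6 mod m 7"
    "\<forall>j. j \<notin> {0, 6, 7, 8, 9, 10, 11} \<longrightarrow> m1 j = m j"
    using euclid_step[OF assms] by blast
  have lt: "m1 7 < m1 6" using m1 assms(2) by simp
  have "\<bar>m1 i\<bar> < 2 ^ u" for i using len_le[OF m1(2), of i] assms(4) by (simp add: len_le_iff)
  from mult_strict_mono'[OF this this, of 6 7] have "m1 6 * m1 7 < 2 ^ (2 * u)"
    using m1(3) by (simp add: euclid_inv_def mult_2 power_add)
  from euclid_loop[OF m1(3) lt this m1(2) assms(4)]
  obtain m' where m': "reaches prog (17, m1, inp, out) (Suc (2 * u) * block_cost u) (48, m', inp, out)"
    "bounded u m' inp" "euclid_inv f x m'" "m' 7 = 0"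
    "\<forall>j. j \<notin> {0, 6, 7, 8, 9, 10, 11} \<longrightarrow> m' j = m1 j" by blast
  have "reaches prog (17, m, inp, out) ((2 * u + 2) * block_cost u) (48, m', inp, out)"
    using reaches_trans[OF m1(1) m'(1)] by simp
  moreover have "m' 6 = gcd f x" using m'(3,4) by (auto simp: euclid_inv_def)
  moreover from this have "f dvd gcd f x - m' 8 * x" using m'(3) by (auto simp: euclid_inv_def)
  ultimately show ?thesis using m' m1(6) by (intro exI[of _ m']) auto
qed

section \<open>The three passes\<close>

primrec prefix_gcd :: "(nat \<Rightarrow> int) \<Rightarrow> nat \<Rightarrow> int" where
  "prefix_gcd a 0 = a 0"
| "prefix_gcd a (Suc i) = gcd (prefix_gcd a i) (a (Suc i))"

text \<open>Record \<open>k\<close> belongs to entry \<open>Suc k\<close>, since entry 0 needs no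
  factor. The factor is specified only by its congruence, which is all that the backward pass
  uses.\<close>

definition cell :: "(nat \<Rightarrow> int) \<Rightarrow> (nat \<Rightarrow> int) \<Rightarrow> nat \<Rightarrow> bool" where
  "cell a m k \<longleftrightarrow>
     prefix_gcd a k dvd prefix_gcd a (Suc k) - m (12 + 3 * k) * a (Suc k) \<and>
     m (13 + 3 * k) = prefix_gcd a k div prefix_gcd a (Suc k) \<and>
     m (14 + 3 * k) = a (Suc k) div prefix_gcd a (Suc k)"

lemma cell_cong: "(\<And>j. 12 + 3 * k \<le> j \<Longrightarrow> j \<le> 14 + 3 * k \<Longrightarrow> m' j = m j) \<Longrightarrow> cell a m' k = cell a m k"
  unfolding cell_def by simp

lemma prefix_gcd_pos: "(\<And>i. i \<le> k \<Longrightarrow> 0 < a i) \<Longrightarrow> 0 < prefix_gcd a k"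
  by (induction k) auto

lemma forward_step:
  assumes pos: "\<And>j. j \<le> Suc i \<Longrightarrow> 0 < a j"
    and m: "m 2 = int c + 2" "m 3 = int (12 + 3 * i)" "m 4 = prefix_gcd a i" "\<forall>k<i. cell a m k"
    and b: "bounded u m (a (Suc i) # inp)" and u: "4 \<le> u" "len (int (12 + 3 * Suc i)) \<le> u"
  shows "\<exists>m'. reaches prog (4, m, a (Suc i) # inp, out) ((2 * u + 4) * block_cost u) (4, m', inp, out) \<and>
    bounded u m' inp \<and> m' 2 = int c + 1 \<and> m' 3 = int (12 + 3 * Suc i) \<and>
    m' 4 = prefix_gcd a (Suc i) \<and> (\<forall>k<Suc i. cell a m' k)"
proof -
  define f x p where "f = prefix_gcd a i" and "x = a (Suc i)" and "p = 12 + 3 * i"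
  have f: "0 < f" unfolding f_def using pos by (intro prefix_gcd_pos) auto
  have x: "0 < x" unfolding x_def using pos by auto
  define m1 where "m1 = m(2 := m 2 - 1, 5 := x, 6 := m 4, 7 := x, 8 := 0, 0 := 1, 9 := 1)"
  have r1: "reaches prog (4, m, x # inp, out) (block_cost u) (17, m1, inp, out)"
    unfolding m1_def using m(1) b u by (intro reaches_block[OF forward_block]) (auto simp: x_def)
  have bm: "bounded u m inp" and lx: "len x \<le> u" using b by (auto simp: bounded_def x_def)
  have l2: "len (m 2 - 1) \<le> u"
    using len_mono[of "m 2 - 1" "m 2"] len_le[OF bm, of 2] m(1) by simp
  have l01: "len 0 \<le> u" "len 1 \<le> u" using u(1) by (auto simp: len_le_iff)
  have b1: "bounded u m1 inp" unfolding m1_def by (intro bounded_upd bm len_le[OF bm] l2 lx l01)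
  \<comment> \<open>The starting coefficients are 0 for \<open>f\<close> and 1 for
    \<open>x\<close>.\<close>
  have inv: "euclid_inv f x m1"
    using f x m(3) by (simp add: euclid_inv_def m1_def f_def)
  obtain m2 where m2: "reaches prog (17, m1, inp, out) ((2 * u + 2) * block_cost u) (48, m2, inp, out)"
    "bounded u m2 inp" "m2 6 = gcd f x" "f dvd gcd f x - m2 8 * x"
    "\<forall>j. j \<notin> {0, 6, 7, 8, 9, 10, 11} \<longrightarrow> m2 j = m1 j"
    using euclid_correct[OF inv _ b1 u(1)] x by (auto simp: m1_def)
  define m3 where "m3 = m2(p := m2 8, p + 1 := m2 4 div m2 6, p + 2 := m2 5 div m2 6,
    3 := int p + 3, 0 := m2 6, 4 := m2 6)"
  have p: "m2 3 = int p" "12 \<le> p" using m2(5) m(2) by (auto simp: m1_def p_def)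
  have g: "m2 6 \<noteq> 0" using m2(3) f by simp
  have r3: "reaches prog (48, m2, inp, out) (block_cost u) (4, m3, inp, out)"
    unfolding m3_def using m2(2) u(1) by (intro reaches_block[OF append_block[OF p g]]) auto
  have "bounded u m3 inp"
    unfolding m3_def using u(2)
    by (intro bounded_upd m2(2) len_le[OF m2(2)] order_trans[OF len_div len_le[OF m2(2)]])
       (simp add: p_def algebra_simps)
  moreover have "reaches prog (4, m, x # inp, out) ((2 * u + 4) * block_cost u) (4, m3, inp, out)"
    using reaches_trans[OF reaches_trans[OF r1 m2(1)] r3] by (simp add: algebra_simps)
  moreover have "m3 2 = int c + 1" "m3 3 = int (12 + 3 * Suc i)" "m3 4 = prefix_gcd a (Suc i)"
    using p(2) m2(3,5) m(1) by (auto simp: m3_def m1_def p_def f_def x_def)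
  moreover have "cell a m3 k" if "k < Suc i" for k
  proof (cases "k = i")
    case True
    have "m2 4 = f" "m2 5 = x" using m2(5) m(3) by (auto simp: m1_def f_def)
    then show ?thesis unfolding True cell_def using m2(3,4)
      by (simp add: m3_def p_def f_def x_def)
  next
    case False
    then have "k < i" using that by simp
    then have "cell a m3 k = cell a m k"
      using m2(5) by (intro cell_cong) (auto simp: m3_def m1_def p_def)
    then show ?thesis using m(4) \<open>k < i\<close> by simp
  qed
  ultimately show ?thesis unfolding x_def by blast
qed

text \<open>The counter is one ahead of the \<open>c\<close> unread entries because the loop
  decrements it before testing for zero.\<close>

lemma forward_pass:
  assumes pos: "\<And>j. j \<le> i + c \<Longrightarrow> 0 < a j"
    and m: "m 2 = int c + 1" "m 3 = int (12 + 3 * i)" "m 4 = prefix_gcd a i" "\<forall>k<i. cell a m k"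
    and b: "bounded u m (map a [Suc i..<Suc (i + c)] @ inp)"
    and u: "4 \<le> u" "len (int (12 + 3 * (i + c))) \<le> u"
  shows "\<exists>m'. reaches prog (4, m, map a [Suc i..<Suc (i + c)] @ inp, out)
      (Suc (c * (2 * u + 4)) * block_cost u) (68, m', inp, out) \<and>
    bounded u m' inp \<and> m' 2 = 0 \<and> m' 3 = int (12 + 3 * (i + c)) \<and> (\<forall>k<i + c. cell a m' k)"
  using assms
proof (induction c arbitrary: i m)
  case 0
  define m' where "m' = m(0 := 0, 2 := 0)"
  have "reaches prog (4, m, inp, out) (block_cost u) (68, m', inp, out)"
    unfolding m'_def using 0 by (intro reaches_block[OF forward_exit_block]) auto
  moreover have "bounded u m' inp"
    unfolding m'_def using 0 by (intro bounded_upd) (auto simp: len_le_iff)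
  moreover have "cell a m' k = cell a m k" for k
    by (intro cell_cong) (auto simp: m'_def)
  moreover have "m' 2 = 0" "m' 3 = m 3" by (auto simp: m'_def)
  ultimately show ?case using 0 by (intro exI[of _ m']) auto
next
  case (Suc c)
  define rest where "rest = map a [Suc (Suc i)..<Suc (Suc i + c)] @ inp"
  have split: "map a [Suc i..<Suc (i + Suc c)] @ inp = a (Suc i) # rest"
    unfolding rest_def by (subst upt_conv_Cons) auto
  have "len (int (12 + 3 * Suc i)) \<le> u"
    using Suc.prems(8) by (intro order_trans[OF len_mono Suc.prems(8)]) auto
  then obtain m1 where m1:
    "reaches prog (4, m, a (Suc i) # rest, out) ((2 * u + 4) * block_cost u) (4, m1, rest, out)"
    "bounded u m1 rest" "m1 2 = int c + 1" "m1 3 = int (12 + 3 * Suc i)"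
    "m1 4 = prefix_gcd a (Suc i)" "\<forall>k<Suc i. cell a m1 k"
    using forward_step[of i a m c u rest out] Suc.prems split by auto
  obtain m' where m': "reaches prog (4, m1, rest, out)
      (Suc (c * (2 * u + 4)) * block_cost u) (68, m', inp, out)"
    "bounded u m' inp" "m' 2 = 0" "m' 3 = int (12 + 3 * (Suc i + c))" "\<forall>k<Suc i + c. cell a m' k"
    using Suc.IH[of "Suc i" m1] m1 Suc.prems unfolding rest_def by auto
  have "reaches prog (4, m, a (Suc i) # rest, out)
      (Suc (Suc c * (2 * u + 4)) * block_cost u) (68, m', inp, out)"
    using reaches_trans[OF m1(1) m'(1)] by (simp add: algebra_simps)
  then show ?case unfolding split using m' by (intro exI[of _ m']) auto
qed

section \<open>Output pass\<close>

lemma output_pass: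
  assumes "m 2 = int c" "m 3 = int p" "12 \<le> p" "bounded u m inp" "4 \<le> u" "len (int (p + 3 * c)) \<le> u"
  shows "\<exists>m'. reaches prog (108, m, inp, out) (Suc c * block_cost u)
    (117, m', inp, out @ map (\<lambda>k. m (p + 3 * k)) [0..<c])"
  using assms
proof (induction c arbitrary: m p out)
  case 0
  have "reaches prog (108, m, inp, out) (block_cost u) (117, m(0 := 0), inp, out)"
    using 0 by (intro reaches_block[OF output_exit_block]) auto
  then show ?case by auto
next
  case (Suc c)
  define m1 where "m1 = m(2 := m 2 - 1, 0 := int p + 3, 3 := int p + 3)"
  have "reaches prog (108, m, inp, out) (block_cost u) (108, m1, inp, out @ [m p])"
    unfolding m1_def using Suc.prems by (intro reaches_block[OF output_block]) auto
  moreover have b1: "bounded u m1 inp"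
  proof -
    have "len (m 2 - 1) \<le> u"
      using len_mono[of "m 2 - 1" "m 2"] len_le[OF Suc.prems(4), of 2] Suc.prems(1) by simp
    moreover have "len (int p + 3) \<le> u" by (intro order_trans[OF len_mono Suc.prems(6)]) auto
    ultimately show ?thesis unfolding m1_def by (intro bounded_upd Suc.prems)
  qed
  moreover have "m1 2 = int c" "m1 3 = int (p + 3)" using Suc.prems by (simp_all add: m1_def)
  then have "\<exists>m'. reaches prog (108, m1, inp, out @ [m p]) (Suc c * block_cost u)
      (117, m', inp, (out @ [m p]) @ map (\<lambda>k. m1 (p + 3 + 3 * k)) [0..<c])"
    using Suc.prems b1 by (intro Suc.IH) (auto simp: algebra_simps)
  \<comment> \<open>The block changes only registers 0, 2 and 3, which lie below the table.\<close>
  moreover have "(out @ [m p]) @ map (\<lambda>k. m1 (p + 3 + 3 * k)) [0..<c] =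
      out @ map (\<lambda>k. m (p + 3 * k)) [0..<Suc c]"
    using Suc.prems(3) by (simp add: upt_conv_Cons map_Suc_upt[symmetric] m1_def add.assoc del: upt_Suc)
  ultimately show ?case using reaches_trans by fastforce
qed

text \<open>One step of the backward pass: \<open>\<beta>\<close> is the quotient of the remaining right-hand side
  by \<open>gcd f c\<close>, and \<open>v\<close> is the factor of \<open>c\<close> in a representation of \<open>gcd f c\<close>.\<close>
lemma backward_arith:
  fixes f c v \<beta> :: int
  assumes f: "0 < f" and v: "f dvd gcd f c - v * c"
  defines "d \<equiv> f div gcd f c" and "e \<equiv> c div gcd f c"
  defines "x \<equiv> v * \<beta> mod d"
  shows "0 < d" "0 \<le> x" "x < d" "f * ((\<beta> - x * e) div d) = gcd f c * \<beta> - c * x"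
proof -
  define g where "g = gcd f c"
  have g: "0 < g" using f by (simp add: g_def)
  have fd: "f = g * d" and ce: "c = g * e" by (auto simp: d_def e_def g_def)
  show d: "0 < d" using f g fd zero_less_mult_pos by blast
  show "0 \<le> x" "x < d" using d by (auto simp: x_def)
  \<comment> \<open>Cancelling \<open>g\<close> shows that \<open>v\<close> is an inverse of
    \<open>e\<close> modulo \<open>d\<close>, so \<open>x\<close> solves
    \<open>x * e \<equiv> \<beta>\<close> modulo \<open>d\<close>.\<close>
  have "g * d dvd g * (1 - v * e)" using v unfolding g_def[symmetric] by (simp add: right_diff_distrib flip: fd) (simp add: ce mult.left_commute)
  then have "d dvd 1 - v * e" using g by simp
  then have "d dvd (1 - v * e) * \<beta> + (v * \<beta> - x) * e"
    unfolding x_def by (intro dvd_add dvd_mult2) (auto simp: minus_mod_eq_mult_div)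
  then have "d dvd \<beta> - x * e" by (simp add: algebra_simps)
  then have "d * ((\<beta> - x * e) div d) = \<beta> - x * e" by simp
  then have "g * (d * ((\<beta> - x * e) div d)) = g * (\<beta> - x * e)" by simp
  also have "\<dots> = g * \<beta> - c * x" by (simp add: ce algebra_simps)
  finally show "f * ((\<beta> - x * e) div d) = gcd f c * \<beta> - c * x"
    by (simp add: g_def[symmetric] mult.assoc[symmetric] flip: fd)
qed

section \<open>Backward pass and correctness of the program\<close>

text \<open>Here \<open>N\<close> is \<open>n - 1\<close> and \<open>large\<close> is
  \<open>b > G(A)\<close>. The last four assumptions make \<open>u\<close> a common length bound for
  the memory at all block boundaries.\<close>

locale knapsack =
  fixes a :: "nat \<Rightarrow> int" and N :: nat and b :: int and u :: nat
  assumes pos: "\<And>i. i \<le> N \<Longrightarrow> 0 < a i"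
    and coprime: "prefix_gcd a N = 1"
    and large: "(\<Sum>k<N. a (Suc k) * (prefix_gcd a k div prefix_gcd a (Suc k))) - (\<Sum>k\<le>N. a k) < b"
    and len_entries: "\<And>i. i \<le> N \<Longrightarrow> len (a i) \<le> u"
    and len_rhs: "len b \<le> u"
    and len_index: "len (int (12 + 3 * N)) \<le> u"
    and small_le: "4 \<le> u"
begin

abbreviation remaining :: "(nat \<Rightarrow> int) \<Rightarrow> nat \<Rightarrow> int" where
  "remaining m i \<equiv> b - (\<Sum>k\<in>{i..<N}. a (Suc k) * m (12 + 3 * k))"

definition solved :: "(nat \<Rightarrow> int) \<Rightarrow> nat \<Rightarrow> bool" where
  "solved m i \<longleftrightarrow>
     (\<forall>k\<in>{i..<N}. 0 \<le> m (12 + 3 * k) \<and> m (12 + 3 * k) < prefix_gcd a k div prefix_gcd a (Suc k)) \<and>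
     prefix_gcd a i * m 5 = remaining m i"

lemma gcd_pos: "i \<le> N \<Longrightarrow> 0 < prefix_gcd a i"
  using pos by (intro prefix_gcd_pos) auto

text \<open>Each chosen entry is at most \<open>q k - 1\<close>, so the amount subtracted is at most
  \<open>G(A) + a 0 < b + a 0\<close>. This holds at every stage, because the terms still missing
  from the sum would be nonnegative.\<close>

lemma remaining_bounds:
  assumes "solved m i" "i \<le> N"
  shows "- a 0 < remaining m i" "remaining m i \<le> b"
proof -
  define q where "q k = prefix_gcd a k div prefix_gcd a (Suc k)" for k
  have q: "0 < q k" if "k < N" for k
  proof -
    have "prefix_gcd a (Suc k) \<le> prefix_gcd a k"
      using gcd_pos[of k] that by (auto intro: zdvd_imp_le)
    then show ?thesis
      using gcd_pos[of "Suc k"] that unfolding q_def by (simp add: pos_imp_zdiv_pos_iff del: prefix_gcd.simps)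
  qed
  have "(\<Sum>k\<in>{i..<N}. a (Suc k) * m (12 + 3 * k)) \<le> (\<Sum>k\<in>{i..<N}. a (Suc k) * (q k - 1))"
    using assms pos by (intro sum_mono mult_left_mono) (auto simp: solved_def q_def less_imp_le)
  also have "\<dots> \<le> (\<Sum>k<N. a (Suc k) * (q k - 1))"
    using q pos by (intro sum_mono2 mult_nonneg_nonneg) (auto simp: less_imp_le)
  \<comment> \<open>The sum starts at entry 1, whereas \<open>G(A)\<close> subtracts all entries;
    this is where \<open>a 0\<close> comes from.\<close>
  also have "\<dots> = (\<Sum>k<N. a (Suc k) * q k) - ((\<Sum>k\<le>N. a k) - a 0)"
    unfolding lessThan_Suc_atMost[symmetric] sum.lessThan_Suc_shift
    by (simp add: algebra_simps sum_subtractf)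
  also have "\<dots> < b + a 0" using large unfolding q_def by simp
  finally show "- a 0 < remaining m i" by simp
  show "remaining m i \<le> b"
    using assms pos by (auto intro!: sum_nonneg mult_nonneg_nonneg simp: solved_def less_imp_le)
qed

text \<open>In absolute value the quotient is at most the remaining right-hand side, which is below
  \<open>a 0\<close> if negative and at most \<open>b\<close> otherwise. So numbers do not grow
  along the pass.\<close>

lemma len_quotient:
  assumes "solved m i" "i \<le> N"
  shows "len (m 5) \<le> u"
proof -
  have "\<bar>m 5\<bar> \<le> \<bar>prefix_gcd a i * m 5\<bar>"
    using gcd_pos[OF assms(2)] mult_right_mono[of 1 "prefix_gcd a i" "\<bar>m 5\<bar>"] by (simp add: abs_mult)
  also have "\<dots> = \<bar>remaining m i\<bar>" using assms(1) by (simp add: solved_def)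
  finally have "\<bar>m 5\<bar> \<le> \<bar>a 0\<bar> \<or> \<bar>m 5\<bar> \<le> \<bar>b\<bar>"
    using remaining_bounds[OF assms] by linarith
  then show ?thesis using len_mono len_entries[of 0] len_rhs order_trans by blast
qed

lemma backward_step:
  assumes i: "Suc i \<le> N" and m: "m 2 = int (N - Suc i)" "m 3 = int (12 + 3 * Suc i)"
    "\<forall>k<Suc i. cell a m k" and s: "solved m (Suc i)" and bd: "bounded u m inp"
  shows "\<exists>m'. reaches prog (69, m, inp, out) (block_cost u) (69, m', inp, out) \<and>
    bounded u m' inp \<and> m' 2 = int (N - i) \<and> m' 3 = int (12 + 3 * i) \<and>
    (\<forall>k<i. cell a m' k) \<and> solved m' i"
proof -
  define p where "p = 12 + 3 * i"
  define f c g where "f = prefix_gcd a i" and "c = a (Suc i)" and "g = prefix_gcd a (Suc i)"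
  define d e where "d = m (p + 1)" and "e = m (p + 2)"
  define x where "x = m p * m 5 mod d"
  define y where "y = (m 5 - x * e) div d"
  define m' where "m' = m(p := x, 3 := int p, 6 := e, 7 := d, 8 := x, 9 := x, 5 := y, 10 := y,
    0 := m 2 + 1, 2 := m 2 + 1)"
  have "cell a m i" using m(3) by simp
  then have v: "f dvd gcd f c - m p * c" and de: "d = f div gcd f c" "e = c div gcd f c"
    by (auto simp: cell_def f_def c_def p_def d_def e_def)
  have f: "0 < f" unfolding f_def using i by (intro gcd_pos) auto
  note arith = backward_arith(1)[OF f v, folded de]
    backward_arith(2-4)[OF f v, of "m 5", folded de, folded x_def, folded y_def]
  have "reaches prog (69, m, inp, out) (block_cost u) (69, m', inp, out)"
    unfolding m'_def y_def x_def d_def e_def using bd small_le arith(1) m(2)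
    by (intro reaches_block[OF backward_block]) (auto simp: p_def d_def)
  moreover have cells: "\<forall>k<i. cell a m' k"
  proof (intro allI impI)
    fix k assume "k < i"
    then have "cell a m' k = cell a m k" by (intro cell_cong) (auto simp: m'_def p_def)
    then show "cell a m' k" using m(3) \<open>k < i\<close> by simp
  qed
  moreover have s': "solved m' i"
  proof -
    have eq: "m' (12 + 3 * k) = m (12 + 3 * k)" if "k \<in> {Suc i..<N}" for k
      using that by (auto simp: m'_def p_def)
    have xy: "m' (12 + 3 * i) = x" "m' 5 = y" by (simp_all add: m'_def p_def)
    have i_split: "{i..<N} = insert i {Suc i..<N}" using i by auto
    have "f * y = gcd f c * m 5 - c * x" by (rule arith(4))
    also have "gcd f c * m 5 = remaining m (Suc i)" using s by (simp add: solved_def f_def c_def)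
    also have "\<dots> - c * x = remaining m' i"
      unfolding i_split using eq xy by (simp add: c_def)
    finally show ?thesis unfolding solved_def
      using s eq xy arith(2,3) de by (auto simp: solved_def i_split f_def c_def)
  qed
  moreover have "bounded u m' inp"
  proof -
    have "len x \<le> u" using arith(1-3) len_mono[of x d] len_le[OF bd, of "p + 1"] by (simp add: d_def)
    \<comment> \<open>The bound comes from the equation that \<open>y\<close> satisfies, not from
      the operations producing it, which would let it grow.\<close>
    moreover have "len y \<le> u" using len_quotient[OF s'] i by (simp add: m'_def)
    moreover have "len (int p) \<le> u" "len (m 2 + 1) \<le> u"
      using i m(1) by (auto intro!: order_trans[OF len_mono len_index] simp: p_def)
    ultimately show ?thesis
      unfolding m'_def d_def e_def by (intro bounded_upd bd len_le[OF bd])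
  qed
  moreover have "m' 2 = int (N - i)" "m' 3 = int (12 + 3 * i)" using m(1) i by (auto simp: m'_def p_def)
  ultimately show ?thesis by blast
qed

lemma backward_pass:
  assumes "i \<le> N" "m 2 = int (N - i)" "m 3 = int (12 + 3 * i)" "\<forall>k<i. cell a m k" "solved m i"
    "bounded u m inp"
  shows "\<exists>m'. reaches prog (69, m, inp, out) (Suc i * block_cost u) (107, m', inp, out) \<and>
    bounded u m' inp \<and> m' 2 = int N \<and> m' 3 = 12 \<and> solved m' 0"
  using assms
proof (induction i arbitrary: m)
  case 0
  define m' where "m' = m(0 := 0)"
  have "reaches prog (69, m, inp, out) (block_cost u) (107, m', inp, out)"
    unfolding m'_def using 0 small_le by (intro reaches_block[OF backward_exit_block]) auto
  moreover have "bounded u m' inp"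
    unfolding m'_def using 0 small_le by (intro bounded_upd) (auto simp: len_le_iff)
  moreover have "m' 2 = m 2" "m' 3 = m 3" "solved m' 0 = solved m 0"
    by (auto simp: m'_def solved_def)
  ultimately show ?case using 0 by (intro exI[of _ m']) auto
next
  case (Suc i)
  obtain m1 where m1: "reaches prog (69, m, inp, out) (block_cost u) (69, m1, inp, out)"
    "bounded u m1 inp" "m1 2 = int (N - i)" "m1 3 = int (12 + 3 * i)"
    "\<forall>k<i. cell a m1 k" "solved m1 i"
    using backward_step[OF Suc.prems] by blast
  obtain m' where m': "reaches prog (69, m1, inp, out) (Suc i * block_cost u) (107, m', inp, out)"
    "bounded u m' inp" "m' 2 = int N" "m' 3 = 12" "solved m' 0"
    using Suc.IH[OF _ m1(3-6,2)] Suc.prems(1) by auto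
  show ?case using reaches_trans[OF m1(1) m'(1)] m' by (intro exI[of _ m']) auto
qed

lemma prog_correct:
  "\<exists>x t. computes_in_time prog (int (Suc N) # map a [0..<Suc N] @ [b]) (map x [0..<Suc N]) t \<and>
     t \<le> (2 * N * u + 6 * N + 7) * block_cost u \<and> (\<forall>i\<le>N. 0 \<le> x i) \<and> (\<Sum>i\<le>N. a i * x i) = b"
proof -
  let ?rest = "map a [Suc 0..<Suc (0 + N)] @ [b]"
  have input: "int (Suc N) # map a [0..<Suc N] @ [b] = int (Suc N) # a 0 # ?rest"
    by (simp add: upt_conv_Cons del: upt_Suc)
  have len_N: "len (int (Suc N)) \<le> u" by (intro order_trans[OF len_mono len_index]) auto
  have bd_in: "bounded u (\<lambda>_. 0) (int (Suc N) # a 0 # ?rest)"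
    using small_le len_entries len_rhs len_N by (auto simp: bounded_def len_def[of 0])
  define m0 where "m0 = (\<lambda>_ :: nat. 0 :: int)(2 := int (Suc N), 4 := a 0, 0 := 12, 3 := 12)"
  have r0: "reaches prog (0, \<lambda>_. 0, int (Suc N) # a 0 # ?rest, []) (block_cost u) (4, m0, ?rest, [])"
    unfolding m0_def using bd_in small_le by (intro reaches_block[OF init_block]) auto
  have "bounded u (\<lambda>_. 0) ?rest" using bd_in by (simp add: bounded_def)
  moreover have "len 12 \<le> u" by (intro order_trans[OF _ small_le]) (simp add: len_le_iff)
  ultimately have b0: "bounded u m0 ?rest"
    unfolding m0_def using len_N len_entries by (intro bounded_upd) auto
  have "m0 2 = int N + 1" "m0 3 = int (12 + 3 * 0)" "m0 4 = prefix_gcd a 0"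
    by (simp_all add: m0_def)
  then obtain m1 where
    m1: "reaches prog (4, m0, ?rest, []) (Suc (N * (2 * u + 4)) * block_cost u) (68, m1, [b], [])"
    "bounded u m1 [b]" "m1 2 = 0" "m1 3 = int (12 + 3 * (0 + N))" "\<forall>k<0 + N. cell a m1 k"
    using forward_pass[of 0 N a m0 u "[b]" "[]"] pos b0 small_le len_index unfolding add_0 by blast
  define m2 where "m2 = m1(5 := b)"
  have r2: "reaches prog (68, m1, [b], []) (block_cost u) (69, m2, [], [])"
    unfolding m2_def using m1(2) small_le by (intro reaches_block[OF read_rhs_block]) auto
  have b2: "bounded u m2 []"
    unfolding m2_def using m1(2) len_rhs by (auto simp: bounded_def)
  have "cell a m2 k = cell a m1 k" for k by (intro cell_cong) (auto simp: m2_def)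
  \<comment> \<open>By coprimality the last gcd is 1, so \<open>b\<close> itself is the initial
    quotient.\<close>
  moreover have "solved m2 N" by (simp add: solved_def m2_def coprime)
  moreover have "m2 2 = 0" "m2 3 = m1 3" using m1(3) by (auto simp: m2_def)
  ultimately obtain m3 where m3: "reaches prog (69, m2, [], []) (Suc N * block_cost u) (107, m3, [], [])"
    "bounded u m3 []" "m3 2 = int N" "m3 3 = 12" "solved m3 0"
    using backward_pass[of N m2 "[]" "[]"] m1(3-5) b2 by (auto simp: m2_def)
  have r4: "reaches prog (107, m3, [], []) (block_cost u) (108, m3, [], [m3 5])"
    using reaches_block[OF write_block[of m3 "[]" "[]"] _ m3(2) small_le] by simp
  obtain m5 where r5: "reaches prog (108, m3, [], [m3 5]) (Suc N * block_cost u)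
      (117, m5, [], [m3 5] @ map (\<lambda>k. m3 (12 + 3 * k)) [0..<N])"
    using output_pass[of m3 N 12 u "[]" "[m3 5]"] m3 len_index small_le by auto
  define x where "x i = (case i of 0 \<Rightarrow> m3 5 | Suc k \<Rightarrow> m3 (12 + 3 * k))" for i
  have "[m3 5] @ map (\<lambda>k. m3 (12 + 3 * k)) [0..<N] = map x [0..<Suc N]"
    by (simp add: upt_conv_Cons map_Suc_upt[symmetric] x_def del: upt_Suc)
  note r5 = r5[unfolded this]
  define T where "T = block_cost u + Suc (N * (2 * u + 4)) * block_cost u + block_cost u
    + Suc N * block_cost u + block_cost u + Suc N * block_cost u"
  have "reaches prog (0, \<lambda>_. 0, int (Suc N) # a 0 # ?rest, []) T (117, m5, [], map x [0..<Suc N])"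
    unfolding T_def
    by (rule reaches_trans[OF reaches_trans[OF reaches_trans[OF reaches_trans[OF
          reaches_trans[OF r0 m1(1)] r2] m3(1)] r4] r5])
  moreover have "halts_from prog (117, m5, [], map x [0..<Suc N]) (map x [0..<Suc N]) 1"
    by (intro halts_from.halt) (simp_all add: length_prog prog_nth)
  ultimately obtain t where t: "t \<le> T"
    "computes_in_time prog (int (Suc N) # map a [0..<Suc N] @ [b]) (map x [0..<Suc N]) (t + 1)"
    unfolding input computes_in_time_def reaches_def by blast
  \<comment> \<open>One more block cost pays for HALT.\<close>
  have "1 \<le> block_cost u" using small_le by (simp add: block_cost_def)
  then have "t + 1 \<le> T + block_cost u" using t(1) by simp
  also have "\<dots> = (2 * N * u + 6 * N + 7) * block_cost u" by (simp add: T_def algebra_simps)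
  finally have time: "t + 1 \<le> (2 * N * u + 6 * N + 7) * block_cost u" .
  have eq: "a 0 * m3 5 = remaining m3 0" using m3(5) by (simp add: solved_def)
  \<comment> \<open>A multiple of \<open>a 0\<close> above \<open>- a 0\<close> has a quotient above
    -1; this is where \<open>b > G(A)\<close> gives nonnegativity of the first entry.\<close>
  then have "a 0 * (m3 5 + 1) > 0" using remaining_bounds(1)[OF m3(5)] by (simp add: algebra_simps)
  then have "0 \<le> m3 5" using pos[of 0] by (simp add: zero_less_mult_iff)
  then have "\<forall>i\<le>N. 0 \<le> x i" using m3(5) by (auto simp: x_def solved_def split: nat.split)
  moreover have "(\<Sum>i\<le>N. a i * x i) = b"
    unfolding lessThan_Suc_atMost[symmetric] sum.lessThan_Suc_shift
    using eq by (simp add: x_def lessThan_atLeast0)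
  ultimately show ?thesis using t(2) time by blast
qed

end

section \<open>Transfer to matrices and the polynomial bound\<close>

lemma length_le_encoding_size: "length xs \<le> encoding_size xs"
proof (induction xs)
  case (Cons x xs)
  then show ?case using len_ge_1[of x] by (simp add: encoding_size_def)
qed simp

lemma len_le_encoding_size: "k \<in> set xs \<Longrightarrow> len k \<le> encoding_size xs"
  unfolding encoding_size_def by (intro member_le_sum_list) auto

text \<open>Positivity makes the recursion's unnormalized start \<open>A $$ (0, 0)\<close> agree
  with the gcd of a singleton.\<close>

lemma f_gcd_eq:
  assumes "\<And>j. j \<le> i \<Longrightarrow> 0 < A $$ (0, j)"
  shows "f_gcd A i = prefix_gcd (\<lambda>j. A $$ (0, j)) i"
proof -
  have "(GCD j\<in>{..i}. A $$ (0, j)) = prefix_gcd (\<lambda>j. A $$ (0, j)) i"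
    using assms by (induction i) (auto simp: atMost_Suc gcd.commute)
  then show ?thesis by (auto simp: f_gcd_def)
qed

theorem corollary1p1:
  "\<exists>(P :: program) (q :: nat poly).
     \<forall>(n :: nat) (A :: int mat) (b :: int).
       n \<ge> 2 \<longrightarrow>
       A \<in> carrier_mat 1 n \<longrightarrow>
       (\<forall>i<n. A $$ (0, i) > 0) \<longrightarrow>
       (GCD i\<in>{..<n}. A $$ (0, i)) = 1 \<longrightarrow>
       {x :: real vec. x \<in> carrier_vec n \<and> (\<forall>i<n. x $ i \<ge> 0) \<and>
          map_mat real_of_int A *\<^sub>v x = 0\<^sub>v 1} = {0\<^sub>v n} \<longrightarrow>
       b > G A \<longrightarrow>
       (\<exists>(x :: int vec) (t :: nat).
          computes_in_time P (encode_instance A b) (list_of_vec x) t \<and>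
          t \<le> poly q (encoding_size (encode_instance A b)) \<and>
          x \<in> carrier_vec n \<and> (\<forall>i<n. x $ i \<ge> 0) \<and>
          A *\<^sub>v x = vec 1 (\<lambda>_. b))"
\<comment> \<open>With \<open>u\<close> the encoding size plus 8, at most \<open>16 * u ^ 2\<close>
  blocks of cost \<open>4 ^ 40 * u\<close> are charged, giving
  \<open>4 ^ 42 * u ^ 3\<close>.\<close>
proof (intro exI[of _ prog] exI[of _ "Polynomial.smult (4 ^ 42) ([:8, 1:] ^ 3)"] allI impI)
  fix n :: nat and A :: "int mat" and b :: int
  assume n: "n \<ge> 2" and A: "A \<in> carrier_mat 1 n" and pos: "\<forall>i<n. A $$ (0, i) > 0"
    and cop: "(GCD i\<in>{..<n}. A $$ (0, i)) = 1" and large: "b > G A"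
  define a where "a = (\<lambda>i. A $$ (0, i))"
  obtain N where N: "n = Suc N" using n by (cases n) auto
  have dim: "dim_col A = Suc N" using A N by simp
  define inp where "inp = int (Suc N) # map a [0..<Suc N] @ [b]"
  have enc: "encode_instance A b = inp"
    using A N by (auto simp: encode_instance_def inp_def a_def list_of_vec_map dim)
  \<comment> \<open>The summand 8 covers the table pointers up to \<open>12 + 3 * N\<close>: four
    digits for 12 and two for 3, besides those of \<open>N\<close>.\<close>
  define u where "u = 8 + encoding_size inp"
  have f_gcd: "f_gcd A i = prefix_gcd a i" if "i \<le> N" for i
    unfolding a_def using pos that N by (intro f_gcd_eq) auto
  interpret knapsack a N b u
  proof
    show "0 < a i" if "i \<le> N" for i using pos that N by (simp add: a_def)
    \<comment> \<open>From \<open>n \<ge> 2\<close> follows \<open>N \<noteq> 0\<close>, so the gcd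
      branch of \<open>f_gcd\<close> applies.\<close>
    have "f_gcd A N = 1"
      using cop n N by (simp add: f_gcd_def lessThan_Suc_atMost)
    then show "prefix_gcd a N = 1" by (simp add: f_gcd)
    have "(\<Sum>i\<in>{1..<Suc N}. A $$ (0, i) * (f_gcd A (i - 1) div f_gcd A i)) =
        (\<Sum>k<N. a (Suc k) * (prefix_gcd a k div prefix_gcd a (Suc k)))"
      using f_gcd
      by (intro sum.reindex_bij_witness[of _ Suc "\<lambda>i. i - 1"]) (auto simp: a_def)
    then show "(\<Sum>k<N. a (Suc k) * (prefix_gcd a k div prefix_gcd a (Suc k))) - (\<Sum>k\<le>N. a k) < b"
      using large by (simp add: G_def dim a_def lessThan_Suc_atMost)
    have inp_len: "len k \<le> u" if "k \<in> set inp" for k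
      using len_le_encoding_size[OF that] by (simp add: u_def)
    show "len (a i) \<le> u" if "i \<le> N" for i using that by (intro inp_len) (auto simp: inp_def simp del: upt_Suc)
    show "len b \<le> u" by (intro inp_len) (auto simp: inp_def)
    have "len (int (12 + 3 * N)) \<le> len 12 + (len 3 + len (int N))"
      using len_add[of 12 "3 * int N"] len_mult[of 3 "int N"] by simp
    also have "len (int N) \<le> len (int (Suc N))" by (intro len_mono) auto
    also have "\<dots> \<le> encoding_size inp" by (intro len_le_encoding_size) (simp add: inp_def)
    finally show "len (int (12 + 3 * N)) \<le> u"
      using len_le_iff[of 4 12] len_le_iff[of 2 3] by (simp add: u_def)
    show "4 \<le> u" by (simp add: u_def)
  qed
  obtain x t where t: "computes_in_time prog inp (map x [0..<Suc N]) t"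
    "t \<le> (2 * N * u + 6 * N + 7) * block_cost u"
    and x: "\<forall>i\<le>N. 0 \<le> x i" "(\<Sum>i\<le>N. a i * x i) = b"
    using prog_correct unfolding inp_def by blast
  \<comment> \<open>Every number on the tape has at least one digit, so the dimension is bounded by
    the encoding size.\<close>
  have "N \<le> u" using length_le_encoding_size[of inp] by (simp add: inp_def u_def)
  then have "2 * N * u + 6 * N + 7 \<le> 2 * u * u + 6 * u + 7" by (intro add_mono mult_mono) auto
  also have "\<dots> \<le> 16 * (u * u)"
  proof -
    have "6 * u \<le> 6 * (u * u)" "7 * 1 \<le> 7 * (u * u)"
      using small_le by (intro mult_left_mono; simp)+
    then show ?thesis by linarith
  qed
  finally have "(2 * N * u + 6 * N + 7) * block_cost u \<le> 16 * (u * u) * block_cost u"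
    by (rule mult_right_mono) simp
  also have "\<dots> = poly (Polynomial.smult (4 ^ 42) ([:8, 1:] ^ 3)) (encoding_size inp)"
    by (simp add: block_cost_def u_def poly_power power3_eq_cube algebra_simps)
  finally have time: "t \<le> poly (Polynomial.smult (4 ^ 42) ([:8, 1:] ^ 3)) (encoding_size inp)"
    using t(2) by simp
  have "A *\<^sub>v vec n x = vec 1 (\<lambda>_. b)"
    using A N x(2) by (intro eq_vecI) (auto simp: scalar_prod_def a_def lessThan_atLeast0 lessThan_Suc_atMost[symmetric])
  then show "\<exists>(x :: int vec) t.
      computes_in_time prog (encode_instance A b) (list_of_vec x) t \<and>
      t \<le> poly (Polynomial.smult (4 ^ 42) ([:8, 1:] ^ 3)) (encoding_size (encode_instance A b)) \<and>
      x \<in> carrier_vec n \<and> (\<forall>i<n. x $ i \<ge> 0) \<and> A *\<^sub>v x = vec 1 (\<lambda>_. b)"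
    using t(1) time x(1) N unfolding enc
    by (intro exI[of _ "vec n x"] exI[of _ t]) (auto simp: list_of_vec_map[symmetric])
qed

end
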